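(* Let $n$ be a positive integer and let $A = L\cup R$ where $L\subset[1,n]$ and $R\subset[n+1,2n]$, with $1,2n\in A$ and $n\notin A$. Suppose that $A$ is $P_n$ and MSTD. Let $A_1 = A$ and for $l \ge 1$ let $$A_{2l} = \big([(1-l)n,(l+1)n]\setminus\{n\}\big)\cup\{(l+2)n\}$$ and $$A_{2l+1} = (L-ln-1)\cup\big([(1-l)n,(l+1)n]\setminus\{n\}\big)\cup(R+ln).$$ Then $A_1\subset A_2\subset A_3\subset \cdots$, and this sequence of sets alternates between being MSTD and MDTS (the sets $A_{2l-1}$ are MSTD and the sets $A_{2l}$ are MDTS). Furthermore, for $m \ge 3$ the diameter of $A_m$ is $n$ larger than the diameter of $A_{m-1}$.
   Context: For a finite set of integers $A$, $A+A=\{a+b: a,b\in A\}$, $A-A=\{a-b: a,b\in A\}$; for an integer $t$, $A+t=\{a+t:a\in A\}$ and $A-t=\{a-t: a\in A\}$. For integers $x\le y$, $[x,y]=\{x,x+1,\dots,y\}$. A finite set $A$ is MSTD if $|A+A|>|A-A|$ and MDTS if $|A-A|>|A+A|$. The diameter of a finite set is $\max A-\min A$. A set $A\subset[a,b]$ is called $P_n$ if $[2a+n,2b-n]\subset A+A$ and $[-(b-a)+n,(b-a)-n]\subset A-A$; here $A\subset[1,2n]$, so $a=1$, $b=2n$. *)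

theory Defs
  imports Main "HOL-Library.Set_Algebras"
begin

text \<open>
  The sumset of \<open>A\<close> with itself is \<open>A + A\<close> from \<open>Set_Algebras\<close>. The difference set
  needs its own name, because \<open>A - B\<close> on sets denotes the relative complement.
\<close>

definition diffset :: "int set \<Rightarrow> int set \<Rightarrow> int set" where
  "diffset A B = {a - b | a b. a \<in> A \<and> b \<in> B}"

definition MSTD :: "int set \<Rightarrow> bool" where
  "MSTD A \<longleftrightarrow> finite A \<and> card (A + A) > card (diffset A A)"

definition MDTS :: "int set \<Rightarrow> bool" where
  "MDTS A \<longleftrightarrow> finite A \<and> card (diffset A A) > card (A + A)"

definition diam :: "int set \<Rightarrow> int" where
  "diam A = Max A - Min A"

text \<open>Being \<open>P\<^sub>n\<close> is relative to the ambient interval \<open>[a, b]\<close>.\<close>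

definition P_prop :: "int \<Rightarrow> int \<Rightarrow> int \<Rightarrow> int set \<Rightarrow> bool" where
  "P_prop n a b A \<longleftrightarrow>
     A \<subseteq> {a..b} \<and>
     {2 * a + n .. 2 * b - n} \<subseteq> A + A \<and>
     {- (b - a) + n .. (b - a) - n} \<subseteq> diffset A A"

end

theory Submission
  imports Defs
begin

text \<open>
  Write \<open>k = ln\<close>. Passing from \<open>A\<close> to \<open>A\<^bsub>2l+1\<^esub>\<close> moves the two fringes \<open>L\<close> and \<open>R\<close> apart
  by \<open>2k + 1\<close> and fills the gap with an interval punctured at \<open>n\<close>. By \<open>P\<^sub>n\<close>, a sum or difference
  missing from \<open>A + A\<close> or \<open>A - A\<close> is so extreme that it depends only on the fringes, and the same
  holds after the move; hence both \<open>|A + A|\<close> and \<open>|A - A|\<close> grow by exactly \<open>4k + 2\<close>.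
  For \<open>A\<^bsub>2l\<^esub>\<close> the difference set is a full interval of \<open>4k + 2n + 1\<close> integers, while the sumset
  misses \<open>n - 1\<close> integers just below its maximum.
\<close>

lemma mem_sumset: "x \<in> A + B \<longleftrightarrow> (\<exists>a\<in>A. \<exists>b\<in>B. x = a + b)" for A B :: "int set"
  by (auto simp: set_plus_def)

lemma mem_diffset: "x \<in> diffset A B \<longleftrightarrow> (\<exists>a\<in>A. \<exists>b\<in>B. x = a - b)"
  by (auto simp: diffset_def)

lemma finite_diffset: "finite A \<Longrightarrow> finite B \<Longrightarrow> finite (diffset A B)"
  unfolding diffset_def by (rule finite_image_set2) auto

lemma uminus_mem_diffset: "- x \<in> diffset A A \<longleftrightarrow> x \<in> diffset A A"
  unfolding mem_diffset by (metis minus_diff_eq minus_minus)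

text \<open>Centre and radius are the parameters because \<open>[(1 - l) n, (l + 1) n]\<close>
  without \<open>n\<close> is symmetric about \<open>n\<close>: it is
  \<open>punctured n (l * n)\<close>.\<close>

definition punctured :: "int \<Rightarrow> int \<Rightarrow> int set" where
  "punctured c k = {c - k..c + k} - {c}"

text \<open>Relative to \<open>2 * c\<close>, a target \<open>d\<close> must split into two nonzero
  offsets of size at most \<open>k\<close>. Halving works unless one half is 0, that is, unless
  \<open>d\<close> is -1, 0 or 1. The offsets 1 and 2 (up to sign) settle these three cases, which
  is where \<open>2 \<le> k\<close> enters.\<close>

lemma punctured_sumset:
  assumes "2 \<le> k" shows "punctured c k + punctured c k = {2 * c - 2 * k..2 * c + 2 * k}"
proof
  show "punctured c k + punctured c k \<subseteq> {2 * c - 2 * k..2 * c + 2 * k}"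
    by (auto simp: mem_sumset punctured_def)
  show "{2 * c - 2 * k..2 * c + 2 * k} \<subseteq> punctured c k + punctured c k"
  proof
    fix x assume x: "x \<in> {2 * c - 2 * k..2 * c + 2 * k}"
    define d where "d = x - 2 * c"
    have "\<exists>i j. d = i + j \<and> i \<noteq> 0 \<and> j \<noteq> 0 \<and> \<bar>i\<bar> \<le> k \<and> \<bar>j\<bar> \<le> k"
    proof -
      consider "d = 0" | "d = 1" | "d = - 1" | "d \<noteq> 0" "d \<noteq> 1" "d \<noteq> - 1" by blast
      then show ?thesis
      proof cases
        case 1 then show ?thesis using assms by (intro exI[of _ 1] exI[of _ "- 1"]) auto
      next
        case 2 then show ?thesis using assms by (intro exI[of _ 2] exI[of _ "- 1"]) auto
      next
        case 3 then show ?thesis using assms by (intro exI[of _ "- 2"] exI[of _ 1]) auto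
      next
        case 4
        have d: "- 2 * k \<le> d" "d \<le> 2 * k" using x by (auto simp: d_def)
        obtain e where "d = 2 * e \<or> d = 2 * e + 1" by (meson evenE oddE)
        then show ?thesis using 4 d by (intro exI[of _ e] exI[of _ "d - e"]) auto
      qed
    qed
    then obtain i j where "d = i + j" "i \<noteq> 0" "j \<noteq> 0" "\<bar>i\<bar> \<le> k" "\<bar>j\<bar> \<le> k" by blast
    then show "x \<in> punctured c k + punctured c k"
      unfolding mem_sumset punctured_def d_def
      by (intro bexI[of _ "c + i"] bexI[of _ "c + j"]) auto
  qed
qed

text \<open>The reflection \<open>b \<mapsto> 2 * c - b\<close> preserves the set, so its difference
  set is its sumset translated by \<open>- 2 * c\<close>.\<close>

lemma punctured_diffset:
  assumes "2 \<le> k" shows "diffset (punctured c k) (punctured c k) = {- 2 * k..2 * k}"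
proof -
  have reflect: "2 * c - b \<in> punctured c k \<longleftrightarrow> b \<in> punctured c k" for b
    by (auto simp: punctured_def)
  have "x \<in> diffset (punctured c k) (punctured c k) \<longleftrightarrow> x + 2 * c \<in> punctured c k + punctured c k" for x
  proof
    assume "x \<in> diffset (punctured c k) (punctured c k)"
    then obtain a b where "a \<in> punctured c k" "b \<in> punctured c k" "x = a - b"
      by (auto simp: mem_diffset)
    then show "x + 2 * c \<in> punctured c k + punctured c k"
      unfolding mem_sumset using reflect by (intro bexI[of _ a] bexI[of _ "2 * c - b"]) auto
  next
    assume "x + 2 * c \<in> punctured c k + punctured c k"
    then obtain a b where "a \<in> punctured c k" "b \<in> punctured c k" "x + 2 * c = a + b"
      by (auto simp: mem_sumset)
    then show "x \<in> diffset (punctured c k) (punctured c k)"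
      unfolding mem_diffset using reflect by (intro bexI[of _ a] bexI[of _ "2 * c - b"]) auto
  qed
  then show ?thesis
    by (intro set_eqI) (simp only: punctured_sumset[OF assms] atLeastAtMost_iff, linarith)
qed

text \<open>Cut each set into a lower tail, a full block and an upper tail. The tails of
  \<open>Y\<close> are translates of those of \<open>X\<close>, so only the block contributes to the
  change in size, and it lengthens by \<open>s + t\<close>.\<close>

lemma card_stretch_middle:
  fixes X Y :: "int set"
  assumes "finite X" "finite Y" and pq: "p \<le> q + 1" and st: "0 \<le> s + t"
    and X: "{p..q} \<subseteq> X" and Y: "{p - s..q + t} \<subseteq> Y"
    and low: "\<And>x. x < p \<Longrightarrow> x \<in> X \<longleftrightarrow> x - s \<in> Y"
    and high: "\<And>x. q < x \<Longrightarrow> x \<in> X \<longleftrightarrow> x + t \<in> Y"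
  shows "int (card Y) = int (card X) + (s + t)"
proof -
  \<comment> \<open>The bound \<open>u \<le> v + 1\<close> admits an empty block, for which
    \<open>v - u + 1\<close> is still the correct count.\<close>
  have split: "int (card Z) = int (card (Z \<inter> {..<u})) + (v - u + 1) + int (card (Z \<inter> {v<..}))"
    if "finite Z" "u \<le> v + 1" "{u..v} \<subseteq> Z" for Z :: "int set" and u v
  proof -
    have Z: "Z = (Z \<inter> {..<u} \<union> {u..v}) \<union> Z \<inter> {v<..}" using that by auto
    have "card Z = card (Z \<inter> {..<u} \<union> {u..v}) + card (Z \<inter> {v<..})"
      by (subst Z, rule card_Un_disjoint) (use that in auto)
    also have "card (Z \<inter> {..<u} \<union> {u..v}) = card (Z \<inter> {..<u}) + card {u..v}"
      by (rule card_Un_disjoint) (use that in auto)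
    finally show ?thesis using that by simp
  qed
  have "Y \<inter> {..<p - s} = (\<lambda>x. x - s) ` (X \<inter> {..<p})"
  proof -
    have "y \<in> (\<lambda>x. x - s) ` (X \<inter> {..<p})" if "y \<in> Y" "y < p - s" for y
      using that low[of "y + s"] by (intro image_eqI[of _ _ "y + s"]) auto
    then show ?thesis using low by auto
  qed
  then have 1: "card (Y \<inter> {..<p - s}) = card (X \<inter> {..<p})"
    by (simp add: card_image inj_on_def)
  have "Y \<inter> {q + t<..} = (\<lambda>x. x + t) ` (X \<inter> {q<..})"
  proof -
    have "y \<in> (\<lambda>x. x + t) ` (X \<inter> {q<..})" if "y \<in> Y" "q + t < y" for y
      using that high[of "y - t"] by (intro image_eqI[of _ _ "y - t"]) auto
    then show ?thesis using high by auto
  qed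
  then have 2: "card (Y \<inter> {q + t<..}) = card (X \<inter> {q<..})"
    by (simp add: card_image inj_on_def)
  show ?thesis
    using split[OF \<open>finite X\<close> pq X] split[OF \<open>finite Y\<close> _ Y] pq st 1 2 by linarith
qed

text \<open>Sums not involving the extra point twice lie in an interval of
  \<open>n + 4 * k + 1\<close> integers, so there are at most \<open>n + 4 * k + 2\<close> sums. The
  differences fill \<open>4 * k + 2 * n + 1\<close> integers, which is more as soon as
  \<open>2 \<le> n\<close>.\<close>

lemma MDTS_punctured_insert:
  assumes "2 \<le> n" "n \<le> k"
  shows "MDTS (punctured n k \<union> {k + 2 * n})"
proof -
  let ?P = "punctured n k" and ?m = "k + 2 * n"
  let ?E = "?P \<union> {?m}"
  have k: "2 \<le> k" using assms by simp
  have fin: "finite ?E" by (simp add: punctured_def)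
  have E: "e \<le> n + k \<or> e = ?m" if "e \<in> ?E" for e using that by (auto simp: punctured_def)
  have E': "n - k \<le> e" if "e \<in> ?E" for e using that assms by (auto simp: punctured_def)
  have "?E + ?E \<subseteq> {2 * n - 2 * k..3 * n + 2 * k} \<union> {2 * ?m}"
  proof
    fix x assume "x \<in> ?E + ?E"
    then obtain a b where "a \<in> ?E" "b \<in> ?E" "x = a + b" unfolding mem_sumset by blast
    then show "x \<in> {2 * n - 2 * k..3 * n + 2 * k} \<union> {2 * ?m}"
      using E[of a] E[of b] E'[of a] E'[of b] assms by auto
  qed
  then have "card (?E + ?E) \<le> card ({2 * n - 2 * k..3 * n + 2 * k} \<union> {2 * ?m})"
    by (intro card_mono) auto
  also have "\<dots> \<le> card {2 * n - 2 * k..3 * n + 2 * k} + card {2 * ?m}"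
    by (rule card_Un_le)
  finally have sums: "int (card (?E + ?E)) \<le> n + 4 * k + 2"
    using assms by simp
  have "x \<in> diffset ?E ?E" if "0 \<le> x" "x \<le> 2 * k + n" for x
  proof (cases "x \<le> 2 * k")
    case True
    then have "x \<in> diffset ?P ?P" using that by (simp add: punctured_diffset[OF k])
    then show ?thesis by (auto simp: mem_diffset)
  next
    case False
    \<comment> \<open>Here \<open>?m - x\<close> lies in \<open>[n - k, 2 * n - k)\<close>, and
      \<open>n \<le> k\<close> keeps it below the hole at \<open>n\<close>.\<close>
    then show ?thesis unfolding mem_diffset using that assms
      by (intro bexI[of _ ?m] bexI[of _ "?m - x"]) (auto simp: punctured_def)
  qed
  then have "x \<in> diffset ?E ?E" if "\<bar>x\<bar> \<le> 2 * k + n" for x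
    using that uminus_mem_diffset[of x ?E] by (cases "0 \<le> x") auto
  then have "{- (2 * k + n)..2 * k + n} \<subseteq> diffset ?E ?E" by auto
  then have "card {- (2 * k + n)..2 * k + n} \<le> card (diffset ?E ?E)"
    by (intro card_mono finite_diffset fin)
  then have "4 * k + 2 * n + 1 \<le> int (card (diffset ?E ?E))"
    using assms by simp
  with sums assms fin show ?thesis by (simp add: MDTS_def)
qed

text \<open>\<open>card_stretch_middle\<close> applies twice: with shifts \<open>2 * k + 2\<close>
  and \<open>2 * k\<close> for sums, and with \<open>2 * k + 1\<close> on both sides for
  differences. Both totals are \<open>4 * k + 2\<close>, so the strict inequality carries
  over.\<close>

lemma MSTD_spread_fringes:
  assumes "n \<le> k" and L: "L \<subseteq> {1..n}" and R: "R \<subseteq> {n + 1..2 * n}"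
    and one: "1 \<in> L" and top: "2 * n \<in> R" and "n \<notin> L"
    and P: "P_prop n 1 (2 * n) (L \<union> R)" and mstd: "MSTD (L \<union> R)"
  shows "MSTD ((\<lambda>x. x - k - 1) ` L \<union> punctured n k \<union> (\<lambda>x. x + k) ` R)"
proof -
  let ?A = "L \<union> R" and ?P = "punctured n k"
  define B where "B = (\<lambda>x. x - k - 1) ` L \<union> ?P \<union> (\<lambda>x. x + k) ` R"
  have n: "2 \<le> n" using L one \<open>n \<notin> L\<close> by (cases "n = 1") auto
  have k: "2 \<le> k" using n assms by simp
  have finA: "finite ?A" using mstd by (simp add: MSTD_def)
  then have finB: "finite B" by (simp add: B_def punctured_def)
  have PB: "?P \<subseteq> B" and botB: "- k \<in> B" and topB: "k + 2 * n \<in> B"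
    using one top by (auto simp: B_def image_iff intro: bexI[of _ 1] bexI[of _ "2 * n"])
  have bounds_B: "- k \<le> b \<and> b \<le> k + 2 * n" if "b \<in> B" for b
    using that subsetD[OF L] subsetD[OF R] \<open>n \<le> k\<close> n by (fastforce simp: B_def punctured_def)
  have bounds_A: "1 \<le> a \<and> a \<le> 2 * n" if "a \<in> ?A" for a
    using that L R n by auto
  \<comment> \<open>The moved \<open>L\<close> lies below \<open>n - k\<close> and the moved
    \<open>R\<close> above \<open>n + k\<close>, so neither meets \<open>?P\<close> and each fringe
    can be read off from \<open>B\<close>.\<close>
  have low: "a \<in> ?A \<longleftrightarrow> a - k - 1 \<in> B" if "a \<le> n" for a
    using that L R n \<open>n \<notin> L\<close> k by (auto simp: B_def punctured_def)
  have high: "a \<in> ?A \<longleftrightarrow> a + k \<in> B" if "n < a" for a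
    using that L R n k by (auto simp: B_def punctured_def)
  have sums: "int (card (B + B)) = int (card (?A + ?A)) + ((2 * k + 2) + 2 * k)"
  proof (rule card_stretch_middle[where p = "n + 2" and q = "3 * n"])
    show "{n + 2..3 * n} \<subseteq> ?A + ?A" using P by (auto simp: P_prop_def)
    show "{n + 2 - (2 * k + 2)..3 * n + 2 * k} \<subseteq> B + B"
    proof
      fix x assume x: "x \<in> {n + 2 - (2 * k + 2)..3 * n + 2 * k}"
      \<comment> \<open>\<open>?P + ?P\<close> covers the middle. The \<open>n\<close> integers on
        either side come from adding the extreme elements \<open>- k\<close> and
        \<open>k + 2 * n\<close> to points of \<open>?P\<close>, which avoid the hole because
        \<open>n \<le> k\<close>.\<close>
      consider "x < 2 * n - 2 * k" | "x \<in> {2 * n - 2 * k..2 * n + 2 * k}" | "2 * n + 2 * k < x"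
        by fastforce
      then show "x \<in> B + B"
      proof cases
        case 1
        then have "x + k \<in> ?P" using x \<open>n \<le> k\<close> n by (auto simp: punctured_def)
        then show ?thesis unfolding mem_sumset using PB botB
          by (intro bexI[of _ "- k"] bexI[of _ "x + k"]) auto
      next
        case 2
        then have "x \<in> ?P + ?P" by (simp add: punctured_sumset[OF k])
        then show ?thesis using PB by (auto simp: mem_sumset)
      next
        case 3
        then have "x - (k + 2 * n) \<in> ?P" using x \<open>n \<le> k\<close> n by (auto simp: punctured_def)
        then show ?thesis unfolding mem_sumset using PB topB
          by (intro bexI[of _ "k + 2 * n"] bexI[of _ "x - (k + 2 * n)"]) auto
      qed
    qed
    \<comment> \<open>Since all elements of \<open>?A\<close> are at least 1, a sum below
      \<open>n + 2\<close> has both summands at most \<open>n\<close>; each moves by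
      \<open>k + 1\<close>. Dually, as elements are at most \<open>2 * n\<close>, a sum above
      \<open>3 * n\<close> has both summands above \<open>n\<close>, each moving by
      \<open>k\<close>. The bounds on \<open>B\<close> give the converses.\<close>
    show "x \<in> ?A + ?A \<longleftrightarrow> x - (2 * k + 2) \<in> B + B" if x: "x < n + 2" for x
    proof
      assume "x \<in> ?A + ?A"
      then obtain a b where "a \<in> ?A" "b \<in> ?A" "x = a + b" by (auto simp: mem_sumset)
      then show "x - (2 * k + 2) \<in> B + B"
        unfolding mem_sumset using x low[of a] low[of b] bounds_A[of a] bounds_A[of b]
        by (intro bexI[of _ "a - k - 1"] bexI[of _ "b - k - 1"]) auto
    next
      assume "x - (2 * k + 2) \<in> B + B"
      then obtain a b where "a \<in> B" "b \<in> B" "x - (2 * k + 2) = a + b" by (auto simp: mem_sumset)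
      then show "x \<in> ?A + ?A"
        unfolding mem_sumset
        using x low[of "a + k + 1"] low[of "b + k + 1"] bounds_B[of a] bounds_B[of b]
        by (intro bexI[of _ "a + k + 1"] bexI[of _ "b + k + 1"]) auto
    qed
    show "x \<in> ?A + ?A \<longleftrightarrow> x + 2 * k \<in> B + B" if x: "3 * n < x" for x
    proof
      assume "x \<in> ?A + ?A"
      then obtain a b where "a \<in> ?A" "b \<in> ?A" "x = a + b" by (auto simp: mem_sumset)
      then show "x + 2 * k \<in> B + B"
        unfolding mem_sumset using x high[of a] high[of b] bounds_A[of a] bounds_A[of b]
        by (intro bexI[of _ "a + k"] bexI[of _ "b + k"]) auto
    next
      assume "x + 2 * k \<in> B + B"
      then obtain a b where "a \<in> B" "b \<in> B" "x + 2 * k = a + b" by (auto simp: mem_sumset)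
      then show "x \<in> ?A + ?A"
        unfolding mem_sumset
        using x high[of "a - k"] high[of "b - k"] bounds_B[of a] bounds_B[of b]
        by (intro bexI[of _ "a - k"] bexI[of _ "b - k"]) auto
    qed
  qed (use n k finA finB in \<open>auto simp: finite_set_plus\<close>)
  \<comment> \<open>A difference of at least \<open>n\<close> inside \<open>[1, 2n]\<close> forces
    \<open>a > n\<close> and \<open>b \<le> n\<close>, so the fringes separate by
    \<open>k + (k + 1)\<close>.\<close>
  have shift: "x \<in> diffset ?A ?A \<longleftrightarrow> x + (2 * k + 1) \<in> diffset B B" if x: "n - 1 < x" for x
  proof
    assume "x \<in> diffset ?A ?A"
    then obtain a b where "a \<in> ?A" "b \<in> ?A" "x = a - b" by (auto simp: mem_diffset)
    then show "x + (2 * k + 1) \<in> diffset B B"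
      unfolding mem_diffset using x high[of a] low[of b] bounds_A[of a] bounds_A[of b]
      by (intro bexI[of _ "a + k"] bexI[of _ "b - k - 1"]) auto
  next
    assume "x + (2 * k + 1) \<in> diffset B B"
    then obtain a b where "a \<in> B" "b \<in> B" "x + (2 * k + 1) = a - b" by (auto simp: mem_diffset)
    then show "x \<in> diffset ?A ?A"
      unfolding mem_diffset
      using x high[of "a - k"] low[of "b + k + 1"] bounds_B[of a] bounds_B[of b]
      by (intro bexI[of _ "a - k"] bexI[of _ "b + k + 1"]) auto
  qed
  have "int (card (diffset B B)) = int (card (diffset ?A ?A)) + ((2 * k + 1) + (2 * k + 1))"
  proof (rule card_stretch_middle[where p = "- (n - 1)" and q = "n - 1"])
    show "{- (n - 1)..n - 1} \<subseteq> diffset ?A ?A" using P by (auto simp: P_prop_def)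
    \<comment> \<open>The bound \<open>2 * k + n\<close> is \<open>(n - 1) + (2 * k + 1)\<close>,
      the upper end of the stretched block; negative differences follow by symmetry.\<close>
    have "x \<in> diffset B B" if "0 \<le> x" "x \<le> 2 * k + n" for x
    proof (cases "x \<le> 2 * k")
      case True
      then have "x \<in> diffset ?P ?P" using that by (simp add: punctured_diffset[OF k])
      then show ?thesis using PB by (auto simp: mem_diffset)
    next
      case False
      then have "k + 2 * n - x \<in> ?P" using that \<open>n \<le> k\<close> n by (auto simp: punctured_def)
      then show ?thesis unfolding mem_diffset using PB topB
        by (intro bexI[of _ "k + 2 * n"] bexI[of _ "k + 2 * n - x"]) auto
    qed
    then have "x \<in> diffset B B" if "\<bar>x\<bar> \<le> 2 * k + n" for x
      using that uminus_mem_diffset[of x B] by (cases "0 \<le> x") auto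
    then show "{- (n - 1) - (2 * k + 1)..n - 1 + (2 * k + 1)} \<subseteq> diffset B B" by auto
    show "x \<in> diffset ?A ?A \<longleftrightarrow> x - (2 * k + 1) \<in> diffset B B" if "x < - (n - 1)" for x
      using that shift[of "- x"] uminus_mem_diffset[of x ?A]
        uminus_mem_diffset[of "x - (2 * k + 1)" B] by simp
    show "x \<in> diffset ?A ?A \<longleftrightarrow> x + (2 * k + 1) \<in> diffset B B" if "n - 1 < x" for x
      using that by (rule shift)
  qed (use n k finA finB in \<open>auto simp: finite_diffset\<close>)
  with sums mstd finB show ?thesis unfolding B_def[symmetric] MSTD_def by simp
qed

lemma diam_eqI:
  assumes "finite A" "a \<in> A" "b \<in> A" "A \<subseteq> {a..b}" shows "diam A = b - a"
proof -
  have "Max A = b" "Min A = a" using assms by (auto intro!: Max_eqI Min_eqI)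
  then show ?thesis by (simp add: diam_def)
qed

theorem theorem2p8:
  fixes n :: int and A L R :: "int set" and S :: "nat \<Rightarrow> int set"
  assumes "n > 0"
    and "A = L \<union> R"
    and "L \<subseteq> {1..n}"
    and "R \<subseteq> {n + 1..2 * n}"
    and "1 \<in> A" and "2 * n \<in> A" and "n \<notin> A"
    and "P_prop n 1 (2 * n) A"
    and "MSTD A"
    and "S 1 = A"
    and "\<And>l :: nat. l \<ge> 1 \<Longrightarrow>
           S (2 * l) = ({(1 - int l) * n .. (int l + 1) * n} - {n}) \<union> {(int l + 2) * n}"
    and "\<And>l :: nat. l \<ge> 1 \<Longrightarrow>
           S (2 * l + 1) = (\<lambda>x. x - int l * n - 1) ` L
             \<union> ({(1 - int l) * n .. (int l + 1) * n} - {n})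
             \<union> (\<lambda>x. x + int l * n) ` R"
  shows "(\<forall>m\<ge>1. S m \<subseteq> S (m + 1))
       \<and> (\<forall>l\<ge>1. MSTD (S (2 * l - 1)) \<and> MDTS (S (2 * l)))
       \<and> (\<forall>m\<ge>3. diam (S m) = diam (S (m - 1)) + n)"
proof -
  let ?k = "\<lambda>l::nat. int l * n"
  have n: "2 \<le> n" using assms(1,5,7) by (cases "n = 1") auto
  have one: "1 \<in> L" and top: "2 * n \<in> R" and "n \<notin> L"
    using assms(2-7) n by auto
  have L: "1 \<le> x \<and> x < n" if "x \<in> L" for x
    using that subsetD[OF assms(3) that] \<open>n \<notin> L\<close> by (cases "x = n") auto
  have R: "n < x \<and> x \<le> 2 * n" if "x \<in> R" for x
    using subsetD[OF assms(4) that] by simp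
  have k: "n \<le> ?k l" if "l \<ge> 1" for l using that n by simp
  have even: "S (2 * l) = punctured n (?k l) \<union> {?k l + 2 * n}" if "l \<ge> 1" for l
    using assms(11)[OF that] by (simp add: punctured_def algebra_simps)
  have odd: "S (2 * l + 1) =
      (\<lambda>x. x - ?k l - 1) ` L \<union> punctured n (?k l) \<union> (\<lambda>x. x + ?k l) ` R" if "l \<ge> 1" for l
    using assms(12)[OF that] by (simp add: punctured_def algebra_simps)
  have mdts: "MDTS (S (2 * l))" if "l \<ge> 1" for l
    unfolding even[OF that] using n k[OF that] by (rule MDTS_punctured_insert)
  \<comment> \<open>No induction on \<open>l\<close>: every odd-indexed set is compared directly
    with \<open>A\<close>, which is itself the case \<open>l = 0\<close>.\<close>
  have mstd: "MSTD (S (2 * l + 1))" for l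
  proof (cases "l = 0")
    case True
    then show ?thesis using assms(9,10) by simp
  next
    case False
    then have l: "l \<ge> 1" by simp
    show ?thesis unfolding odd[OF l]
      using k[OF l] assms(3,4) one top \<open>n \<notin> L\<close> assms(8,9)[unfolded assms(2)]
      by (rule MSTD_spread_fringes)
  qed
  \<comment> \<open>The isolated point \<open>?k l + 2 * n\<close> is the image of
    \<open>2 * n \<in> R\<close>.\<close>
  have step_even: "S (2 * l) \<subseteq> S (2 * l + 1)" if "l \<ge> 1" for l
    unfolding even[OF that] odd[OF that] using top by (auto simp: image_iff intro: bexI[of _ "2 * n"])
  have step_odd: "S (2 * l + 1) \<subseteq> S (2 * Suc l)" for l
  proof (cases "l = 0")
    case True
    have "A \<subseteq> punctured n n" using assms(2-4,7) by (auto simp: punctured_def)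
    then show ?thesis using True assms(10) even[of 1] by auto
  next
    case False
    then have l: "l \<ge> 1" by simp
    define h where "h = ?k l"
    have "?k (Suc l) = h + n" by (simp add: h_def distrib_right)
    moreover have "n \<le> h" using k[OF l] by (simp only: h_def)
    \<comment> \<open>The next punctured interval has radius \<open>h + n\<close> about
      \<open>n\<close>, hence ends exactly at \<open>- h\<close> and \<open>h + 2 * n\<close>, the
      extremes of the moved fringes; neither fringe hits \<open>n\<close>.\<close>
    ultimately have "S (2 * l + 1) \<subseteq> punctured n (?k (Suc l))"
      unfolding odd[OF l] h_def[symmetric] using n
      by (auto simp: punctured_def dest!: L R)
    then show ?thesis using even[of "Suc l"] by auto
  qed
  \<comment> \<open>The extremes move alternately: from an even index to the next odd one the
    minimum drops by \<open>n\<close>, and from there to the next even index the maximum rises by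
    \<open>n\<close>.\<close>
  have diam_even: "diam (S (2 * l)) = 2 * ?k l + n" if "l \<ge> 1" for l
    unfolding even[OF that] using n k[OF that]
    by (subst diam_eqI[of _ "n - ?k l" "?k l + 2 * n"]) (auto simp: punctured_def)
  have diam_odd: "diam (S (2 * l + 1)) = 2 * ?k l + 2 * n" if "l \<ge> 1" for l
  proof -
    have "finite L" "finite R" using assms(3,4) by (auto intro: finite_subset)
    then have "finite (S (2 * l + 1))" unfolding odd[OF that] by (simp add: punctured_def)
    moreover have "- ?k l \<in> S (2 * l + 1)" "?k l + 2 * n \<in> S (2 * l + 1)"
      unfolding odd[OF that] using one top
      by (auto simp: image_iff intro: bexI[of _ 1] bexI[of _ "2 * n"])
    moreover define h where "h = ?k l"
    moreover have "n \<le> h" using k[OF that] by (simp only: h_def)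
    then have "S (2 * l + 1) \<subseteq> {- h..h + 2 * n}"
      unfolding odd[OF that] h_def[symmetric] using n
      by (auto simp: punctured_def dest!: L R)
    ultimately have "diam (S (2 * l + 1)) = (?k l + 2 * n) - (- ?k l)" by (intro diam_eqI) simp_all
    then show ?thesis by simp
  qed
  have "S m \<subseteq> S (m + 1)" if "m \<ge> 1" for m
  proof (cases "even m")
    case True
    then obtain l where "m = 2 * l" by blast
    then show ?thesis using that step_even[of l] by simp
  next
    case False
    then obtain l where "m = 2 * l + 1" by (rule oddE)
    then show ?thesis using step_odd[of l] by simp
  qed
  moreover have "MSTD (S (2 * l - 1)) \<and> MDTS (S (2 * l))" if "l \<ge> 1" for l
    using that mdts[OF that] mstd[of "l - 1"] by (cases l) auto
  moreover have "diam (S m) = diam (S (m - 1)) + n" if "m \<ge> 3" for m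
  proof (cases "even m")
    case True
    then obtain l where l: "m = 2 * l" by blast
    \<comment> \<open>\<open>j \<ge> 1\<close> matters: \<open>A\<close> has diameter
      \<open>2 * n - 1\<close>, one less than the odd formula would give at 0, so the step from
      index 1 to 2 adds \<open>n + 1\<close>.\<close>
    with that obtain j where "l = Suc j" "j \<ge> 1" by (cases l) auto
    then show ?thesis using l diam_even[of l] diam_odd[of j] by (simp add: algebra_simps)
  next
    case False
    then obtain l where "m = 2 * l + 1" by (rule oddE)
    then show ?thesis using that diam_even[of l] diam_odd[of l] by simp
  qed
  ultimately show ?thesis by blast
qed

end
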